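(* (i) For every integer $q\ge 2$, $\chi_\rho(H_{q,2}) = 1 + q^2 - q$. (ii) For every integer $q \geq 3$, $\chi_\rho(H_{q,3}) = 2 + q^3 - q^2 - q$.
   Context: For integers $q\ge 2$ and $m\ge 1$, the Hamming graph $H_{q,m}$ has vertex set $\{0,\ldots,q-1\}^m$, two vertices being adjacent if and only if they differ in exactly one coordinate. For a graph $G=(V,E)$, a packing $k$-coloring of $G$ is a partition $V_1,\ldots,V_k$ of $V$ such that for every $i\in\{1,\ldots,k\}$, any two distinct vertices $u,v\in V_i$ are at distance at least $i+1$ in $G$; the packing chromatic number $\chi_\rho(G)$ is the smallest $k$ for which a packing $k$-coloring of $G$ exists. *)

theory Defs
  imports "Graph_Theory.Graph_Theory"
begin

(* Vertices are lists of length m with entries below q. An undirected edge is the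
   pair of opposite arcs between its ends. *)
definition hamming_graph :: "nat \<Rightarrow> nat \<Rightarrow> nat list pair_pre_digraph" where
  "hamming_graph q m =
     (let X = {x. length x = m \<and> set x \<subseteq> {0..<q}} in
      \<lparr> pverts = X,
        parcs = {(x, y). x \<in> X \<and> y \<in> X \<and> card {i. i < m \<and> x ! i \<noteq> y ! i} = 1} \<rparr>)"

(* With unit weights, the library's shortest-path value is the least number of arcs on a
   walk from u to v, and it is infinite if there is no such walk. *)
definition graph_dist :: "'a pair_pre_digraph \<Rightarrow> 'a \<Rightarrow> 'a \<Rightarrow> ereal" where
  "graph_dist G u v = wf_digraph.\<mu> (with_proj G) (\<lambda>_. 1) u v"

(* Only the values V 1, ..., V k matter. Classes may be empty; this does not affect
   the smallest k, see packing_coloring_minimal_nonempty below. *)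
definition packing_coloring :: "'a pair_pre_digraph \<Rightarrow> nat \<Rightarrow> (nat \<Rightarrow> 'a set) \<Rightarrow> bool" where
  "packing_coloring G k V \<longleftrightarrow>
     (\<Union>i\<in>{1..k}. V i) = pverts G \<and>
     disjoint_family_on V {1..k} \<and>
     (\<forall>i\<in>{1..k}. \<forall>u\<in>V i. \<forall>v\<in>V i. u \<noteq> v \<longrightarrow> graph_dist G u v \<ge> ereal (real (i + 1)))"

definition packing_chromatic_number :: "'a pair_pre_digraph \<Rightarrow> nat" where
  "packing_chromatic_number G = (LEAST k. \<exists>V. packing_coloring G k V)"

lemma pair_graph_hamming_graph: "pair_graph (hamming_graph q m)"
proof -
  let ?X = "{x::nat list. length x = m \<and> set x \<subseteq> {0..<q}}"
  let ?d = "\<lambda>x y::nat list. card {i. i < m \<and> x ! i \<noteq> y ! i}"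
  have verts: "pverts (hamming_graph q m) = ?X"
    by (simp add: hamming_graph_def Let_def)
  have arcs: "e \<in> parcs (hamming_graph q m) \<longleftrightarrow>
      fst e \<in> ?X \<and> snd e \<in> ?X \<and> ?d (fst e) (snd e) = 1" for e
    by (simp add: hamming_graph_def Let_def case_prod_unfold)
  have fin: "finite ?X"
  proof -
    have "?X = {x. set x \<subseteq> {0..<q} \<and> length x = m}" by blast
    then show ?thesis using finite_lists_length_eq[of "{0..<q}" m] by (simp only: finite_atLeastLessThan)
  qed
  have sub: "parcs (hamming_graph q m) \<subseteq> ?X \<times> ?X"
    using arcs unfolding mem_Times_iff subset_iff by blast
  show ?thesis
  proof
    show "finite (pverts (hamming_graph q m))"
      using fin verts by simp
    show "finite (parcs (hamming_graph q m))"
      by (rule finite_subset[OF sub]) (use fin in blast)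
    have "sym (parcs (hamming_graph q m))"
    proof (rule symI)
      fix x y assume "(x, y) \<in> parcs (hamming_graph q m)"
      moreover have "{i. i < m \<and> x ! i \<noteq> y ! i} = {i. i < m \<and> y ! i \<noteq> x ! i}"
        by (rule Collect_cong) metis
      ultimately show "(y, x) \<in> parcs (hamming_graph q m)"
        unfolding arcs fst_conv snd_conv by (simp only: simp_thms)
    qed
    then show "symmetric (with_proj (hamming_graph q m))"
      by (simp add: symmetric_def)
  next
    fix e assume e: "e \<in> parcs (hamming_graph q m)"
    show "fst e \<in> pverts (hamming_graph q m)"
      using e unfolding arcs verts by (elim conjE)
    show "snd e \<in> pverts (hamming_graph q m)"
      using e unfolding arcs verts by (elim conjE)
    show "fst e \<noteq> snd e"
    proof
      assume eq: "fst e = snd e"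
      have "?d (fst e) (snd e) = 1"
        using e unfolding arcs by (elim conjE)
      moreover have "?d (fst e) (snd e) = 0"
        unfolding eq by simp
      ultimately show False by linarith
    qed
  qed
qed

lemma packing_coloring_minimal_nonempty:
  assumes col: "packing_coloring G k V"
    and min: "\<And>l W. packing_coloring G l W \<Longrightarrow> k \<le> l"
    and i: "i \<in> {1..k}"
  shows "V i \<noteq> {}"
proof
  assume empty: "V i = {}"
  define W where "W = V(i := V k)"
  have k: "{1..k} = insert k {1..k - 1}" "k \<notin> {1..k - 1}" "k \<ge> 1" using i by auto
  have V_cover: "(\<Union>j\<in>{1..k}. V j) = pverts G"
    and V_disj: "disjoint_family_on V {1..k}"
    and V_dist: "\<And>j u v. \<lbrakk>j \<in> {1..k}; u \<in> V j; v \<in> V j; u \<noteq> v\<rbrakk>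
      \<Longrightarrow> ereal (real (j + 1)) \<le> graph_dist G u v"
    using col by (auto simp: packing_coloring_def)
  have "packing_coloring G (k - 1) W"
    unfolding packing_coloring_def
  proof (intro conjI ballI impI)
    show "(\<Union>j\<in>{1..k - 1}. W j) = pverts G"
    proof (cases "i = k")
      case True
      then show ?thesis using V_cover empty k by (auto simp: W_def)
    next
      case False
      then have "i \<in> {1..k - 1}" using i by auto
      then have "(\<Union>j\<in>{1..k - 1}. W j) = (\<Union>j\<in>{1..k}. V j)"
        using empty k(1) by (auto simp: W_def split: if_splits)
      then show ?thesis using V_cover by simp
    qed
    show "disjoint_family_on W {1..k - 1}"
      unfolding disjoint_family_on_def
    proof (intro ballI impI)
      fix a b assume ab: "a \<in> {1..k - 1}" "b \<in> {1..k - 1}" "a \<noteq> b"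
      have *: "V c \<inter> V d = {}" if "c \<in> {1..k}" "d \<in> {1..k}" "c \<noteq> d" for c d
        using V_disj that by (auto simp: disjoint_family_on_def)
      show "W a \<inter> W b = {}"
        using ab k *[of a b] *[of a k] *[of k b] by (auto simp: W_def)
    qed
    fix j u v assume j: "j \<in> {1..k - 1}" and uv: "u \<in> W j" "v \<in> W j" "u \<noteq> v"
    show "ereal (real (j + 1)) \<le> graph_dist G u v"
    proof (cases "j = i")
      case True
      then have "ereal (real (k + 1)) \<le> graph_dist G u v"
        using uv k V_dist[of k u v] by (simp add: W_def)
      moreover have "ereal (real (j + 1)) \<le> ereal (real (k + 1))" using j by auto
      ultimately show ?thesis by (rule order_trans[rotated])
    next
      case False
      then show ?thesis using uv j V_dist[of j u v] by (auto simp: W_def)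
    qed
  qed
  from min[OF this] k(3) show False by simp
qed

end

theory Submission
  imports Defs "HOL-Combinatorics.Transposition" "HOL-Number_Theory.Cong"
begin

(* In a Hamming graph the graph distance is the Hamming distance, so the i-th colour class is a
   code of minimum distance at least i + 1. By the Singleton bound it has at most q^(m - i)
   elements for i < m, and at most one element for i \<ge> m. Conversely, disjoint MDS codes of minimum
   distance i + 1 for i < m, completed by singletons, give an optimal coloring. For m = 2 take
   the diagonal; for m = 3 take the Latin square z = x + y mod q and the q words (i, i, t(i)), where
   t exchanges 0 and 1, so that t(i) differs from 2i mod q for all i as soon as q \<ge> 3. *)

section \<open>Hamming distance of words\<close>

definition hamming_dist :: "nat \<Rightarrow> 'a list \<Rightarrow> 'a list \<Rightarrow> nat" where
  "hamming_dist m u v = card {i. i < m \<and> u ! i \<noteq> v ! i}"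

lemma hamming_dist_0 [simp]: "hamming_dist 0 u v = 0"
  by (simp add: hamming_dist_def)

text \<open>Evaluates distances between explicitly written words once the numerals 2 and 3 are
  unfolded to successors.\<close>

lemma hamming_dist_Suc_Cons [simp]:
  "hamming_dist (Suc m) (x # u) (y # v) = of_bool (x \<noteq> y) + hamming_dist m u v"
proof -
  have "{i. i < Suc m \<and> (x # u) ! i \<noteq> (y # v) ! i} =
      (if x \<noteq> y then {0} else {}) \<union> Suc ` {i. i < m \<and> u ! i \<noteq> v ! i}"
    by (auto simp: less_Suc_eq_0_disj nth_Cons' image_iff)
  then show ?thesis
    by (auto simp: hamming_dist_def card_image card_insert_if)
qed

lemma hamming_dist_triangle: "hamming_dist m u w \<le> hamming_dist m u v + hamming_dist m v w"
proof -
  \<comment> \<open>Where \<open>u\<close> and \<open>w\<close> differ, \<open>v\<close> cannot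
    agree with both.\<close>
  have "hamming_dist m u w \<le> card ({i. i < m \<and> u ! i \<noteq> v ! i} \<union> {i. i < m \<and> v ! i \<noteq> w ! i})"
    unfolding hamming_dist_def by (rule card_mono) auto
  also have "\<dots> \<le> hamming_dist m u v + hamming_dist m v w"
    unfolding hamming_dist_def by (rule card_Un_le)
  finally show ?thesis .
qed

lemma hamming_dist_eq_0_iff:
  assumes "length u = m" "length v = m"
  shows "hamming_dist m u v = 0 \<longleftrightarrow> u = v"
  using assms by (auto simp: hamming_dist_def list_eq_iff_nth_eq)

section \<open>Graph distance equals Hamming distance\<close>

lemma pverts_hamming_graph:
  "pverts (hamming_graph q m) = {x. set x \<subseteq> {0..<q} \<and> length x = m}"
  by (auto simp: hamming_graph_def)

lemma parcs_hamming_graph: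
  "parcs (hamming_graph q m) =
    {(x, y). x \<in> pverts (hamming_graph q m) \<and> y \<in> pverts (hamming_graph q m) \<and>
      hamming_dist m x y = 1}"
  by (auto simp: hamming_graph_def hamming_dist_def Let_def)

lemma finite_pverts_hamming_graph: "finite (pverts (hamming_graph q m))"
  unfolding pverts_hamming_graph by (rule finite_lists_length_eq) simp

lemma card_pverts_hamming_graph: "card (pverts (hamming_graph q m)) = q ^ m"
  unfolding pverts_hamming_graph by (subst card_lists_length_eq) simp_all

lemma wf_hamming_graph: "wf_digraph (with_proj (hamming_graph q m))"
proof -
  interpret pair_graph "hamming_graph q m" by (rule pair_graph_hamming_graph)
  show ?thesis by unfold_locales
qed

text \<open>Each arc changes a single coordinate, so by the triangle inequality a walk cannot change
  more coordinates than it has arcs.\<close>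

lemma hamming_dist_le_length_awalk:
  assumes "pre_digraph.awalk (with_proj (hamming_graph q m)) u p v"
  shows "hamming_dist m u v \<le> length p"
  using assms
proof (induction p arbitrary: u)
  case Nil
  then show ?case
    by (simp add: wf_digraph.awalk_Nil_iff[OF wf_hamming_graph] hamming_dist_def)
next
  case (Cons e p)
  then have "hamming_dist m u (snd e) = 1" "hamming_dist m (snd e) v \<le> length p"
    by (auto simp: wf_digraph.awalk_Cons_iff[OF wf_hamming_graph] parcs_hamming_graph)
  then show ?case
    using hamming_dist_triangle[of m u v "snd e"] by simp
qed

text \<open>Correct the wrong coordinates of \<open>u\<close> one at a time; the induction is on
  their number.\<close>

lemma awalk_of_length_hamming_dist:
  assumes "u \<in> pverts (hamming_graph q m)" "v \<in> pverts (hamming_graph q m)"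
  obtains p where "pre_digraph.awalk (with_proj (hamming_graph q m)) u p v"
    and "length p = hamming_dist m u v"
  using assms(1)
proof (induction "hamming_dist m u v" arbitrary: u thesis)
  case 0
  then have "u = v"
    using assms(2) hamming_dist_eq_0_iff[of u m v] by (simp add: pverts_hamming_graph)
  then show ?case
    using 0 by (intro "0.prems"(1)[of "[]"])
      (auto simp: wf_digraph.awalk_Nil_iff[OF wf_hamming_graph] hamming_dist_def)
next
  case (Suc n)
  let ?D = "{i. i < m \<and> u ! i \<noteq> v ! i}"
  have "?D \<noteq> {}"
    using Suc.hyps(2) unfolding hamming_dist_def by (metis card.empty nat.distinct(2))
  then obtain i where i: "i < m" "u ! i \<noteq> v ! i"
    by auto
  define w where "w = u[i := v ! i]"
  have len: "length u = m" "length v = m"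
    using Suc.prems assms(2) by (auto simp: pverts_hamming_graph)
  have w: "w \<in> pverts (hamming_graph q m)"
    using Suc.prems(2) assms(2) i set_update_subset_insert[of u i "v ! i"]
    by (force simp: w_def pverts_hamming_graph)
  have "{j. j < m \<and> u ! j \<noteq> w ! j} = {i}"
    using i len by (auto simp: w_def nth_list_update)
  then have uw: "hamming_dist m u w = 1"
    by (simp add: hamming_dist_def)
  have "{j. j < m \<and> w ! j \<noteq> v ! j} = ?D - {i}"
    using i len by (auto simp: w_def nth_list_update)
  then have "n = hamming_dist m w v"
    using Suc.hyps(2) i by (simp add: hamming_dist_def)
  then obtain p where p: "pre_digraph.awalk (with_proj (hamming_graph q m)) w p v"
      "length p = hamming_dist m w v"
    using Suc.hyps(1) w by blast
  show ?case
    using p uw w Suc.prems(2) Suc.hyps(2) \<open>n = hamming_dist m w v\<close>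
    by (intro Suc.prems(1)[of "(u, w) # p"])
      (auto simp: wf_digraph.awalk_Cons_iff[OF wf_hamming_graph] parcs_hamming_graph)
qed

lemma graph_dist_hamming_graph:
  assumes "u \<in> pverts (hamming_graph q m)" "v \<in> pverts (hamming_graph q m)"
  shows "graph_dist (hamming_graph q m) u v = ereal (real (hamming_dist m u v))"
proof -
  interpret wf_digraph "with_proj (hamming_graph q m)" by (rule wf_hamming_graph)
  have cost: "awalk_cost (\<lambda>_. 1) p = real (length p)" for p :: "(nat list \<times> nat list) list"
    by (simp add: awalk_cost_def sum_list_triv)
  obtain p where p: "awalk u p v" "length p = hamming_dist m u v"
    using awalk_of_length_hamming_dist[OF assms] .
  show ?thesis
    unfolding graph_dist_def
  \<comment> \<open>\<open>\<mu>\<close> is an infimum over walks: the walk just obtained bounds it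
    from above, and the minimal length of every walk bounds it from below.\<close>
  proof (rule antisym)
    show "\<mu> (\<lambda>_. 1) u v \<le> ereal (real (hamming_dist m u v))"
      using min_cost_le_walk_cost[OF p(1), of "\<lambda>_. 1"] p(2) by (simp add: cost)
    show "ereal (real (hamming_dist m u v)) \<le> \<mu> (\<lambda>_. 1) u v"
      unfolding \<mu>_def using hamming_dist_le_length_awalk
      by (intro INF_greatest) (simp add: cost)
  qed
qed

section \<open>Lower bound from the Singleton bound\<close>

lemma singleton_bound:
  assumes sub: "C \<subseteq> pverts (hamming_graph q m)"
    and dist: "\<And>u v. \<lbrakk>u \<in> C; v \<in> C; u \<noteq> v\<rbrakk> \<Longrightarrow> d < hamming_dist m u v"
  shows "card C \<le> q ^ (m - d)"
proof -
  \<comment> \<open>Words with the same prefix of length \<open>m - d\<close> differ in at most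
    \<open>d\<close> places. For d \<ge> m subtraction truncates, the prefix is empty and the bound
    is 1.\<close>
  have "inj_on (take (m - d)) C"
  proof (rule inj_onI, rule ccontr)
    fix u v assume uv: "u \<in> C" "v \<in> C" "take (m - d) u = take (m - d) v" "u \<noteq> v"
    have "u ! i = v ! i" if "i < m - d" for i
      using that uv(3) by (metis nth_take)
    then have "{i. i < m \<and> u ! i \<noteq> v ! i} \<subseteq> {m - d..<m}"
      by (auto simp: not_less[symmetric])
    then have "hamming_dist m u v \<le> card {m - d..<m}"
      unfolding hamming_dist_def by (intro card_mono) auto
    then show False
      using dist[of u v] uv by simp
  qed
  moreover have "take (m - d) ` C \<subseteq> pverts (hamming_graph q (m - d))"
    using sub by (fastforce simp: pverts_hamming_graph dest: in_set_takeD)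
  ultimately have "card C \<le> card (pverts (hamming_graph q (m - d)))"
    by (rule card_inj_on_le[OF _ _ finite_pverts_hamming_graph])
  then show ?thesis
    by (simp add: card_pverts_hamming_graph)
qed

lemma packing_coloring_hamming_graph_iff:
  "packing_coloring (hamming_graph q m) k V \<longleftrightarrow>
     (\<Union>i\<in>{1..k}. V i) = pverts (hamming_graph q m) \<and>
     disjoint_family_on V {1..k} \<and>
     (\<forall>i\<in>{1..k}. \<forall>u\<in>V i. \<forall>v\<in>V i. u \<noteq> v \<longrightarrow> i < hamming_dist m u v)"
proof -
  \<comment> \<open>The distance formula needs vertices, and classes consist of vertices by the
    covering condition; \<open>conj_cong\<close> makes that condition available below.\<close>
  have "graph_dist (hamming_graph q m) u v \<ge> ereal (real (i + 1)) \<longleftrightarrow> i < hamming_dist m u v"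
    if "(\<Union>i\<in>{1..k}. V i) = pverts (hamming_graph q m)" "i \<in> {1..k}" "u \<in> V i" "v \<in> V i"
    for i u v
  proof -
    have "u \<in> pverts (hamming_graph q m)" "v \<in> pverts (hamming_graph q m)"
      using that by blast+
    then show ?thesis
      by (simp add: graph_dist_hamming_graph) linarith
  qed
  then show ?thesis
    unfolding packing_coloring_def by (intro conj_cong ball_cong imp_cong refl) blast
qed

lemma hamming_packing_coloring_bound:
  assumes "packing_coloring (hamming_graph q m) k V"
  shows "q ^ m \<le> (\<Sum>i = 1..k. q ^ (m - i))"
proof -
  have V: "(\<Union>i\<in>{1..k}. V i) = pverts (hamming_graph q m)"
    and dist: "\<And>i u v. \<lbrakk>i \<in> {1..k}; u \<in> V i; v \<in> V i; u \<noteq> v\<rbrakk> \<Longrightarrow> i < hamming_dist m u v"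
    using assms unfolding packing_coloring_hamming_graph_iff by blast+
  have "q ^ m = card (\<Union>i\<in>{1..k}. V i)"
    unfolding V card_pverts_hamming_graph ..
  also have "\<dots> \<le> (\<Sum>i = 1..k. card (V i))"
    by (rule card_UN_le) simp
  also have "\<dots> \<le> (\<Sum>i = 1..k. q ^ (m - i))"
    using V dist by (intro sum_mono singleton_bound) blast+
  finally show ?thesis .
qed

section \<open>Completing disjoint codes to an optimal coloring\<close>

lemma packing_coloring_extend_by_singletons:
  assumes fin: "finite (pverts G)"
    and sub: "(\<Union>i\<in>{1..t}. W i) \<subseteq> pverts G"
    and disj: "disjoint_family_on W {1..t}"
    and dist: "\<And>i u v. \<lbrakk>i \<in> {1..t}; u \<in> W i; v \<in> W i; u \<noteq> v\<rbrakk>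
      \<Longrightarrow> graph_dist G u v \<ge> ereal (real (i + 1))"
  shows "\<exists>V. packing_coloring G (t + card (pverts G - (\<Union>i\<in>{1..t}. W i))) V"
proof -
  let ?R = "pverts G - (\<Union>i\<in>{1..t}. W i)"
  let ?k = "t + card ?R"
  \<comment> \<open>\<open>h\<close> gives each uncovered vertex a color of its own beyond
    \<open>t\<close>; a one-element class meets every distance requirement vacuously.\<close>
  have "\<exists>h. bij_betw h {Suc t..?k} ?R"
    using fin by (intro finite_same_card_bij) auto
  then obtain h where h: "bij_betw h {Suc t..?k} ?R" ..
  define V where "V i = (if i \<le> t then W i else {h i})" for i
  have split: "{1..?k} = {1..t} \<union> {Suc t..?k}"
    by auto
  have hR: "h i \<in> ?R" if "i \<in> {1..?k}" "\<not> i \<le> t" for i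
    using that bij_betwE[OF h] by auto
  have h_inj: "h i \<noteq> h j" if "i \<in> {1..?k}" "\<not> i \<le> t" "j \<in> {1..?k}" "\<not> j \<le> t" "i \<noteq> j" for i j
    using that inj_onD[OF bij_betw_imp_inj_on[OF h], of i j] by auto
  have "packing_coloring G ?k V"
    unfolding packing_coloring_def
  proof (intro conjI ballI impI)
    have "(\<Union>i\<in>{1..?k}. V i) = (\<Union>i\<in>{1..t}. W i) \<union> h ` {Suc t..?k}"
      unfolding split UN_Un by (rule arg_cong2[where f = "(\<union>)"]) (auto simp: V_def)
    then show "(\<Union>i\<in>{1..?k}. V i) = pverts G"
      by (simp only: bij_betw_imp_surj_on[OF h] Un_Diff_cancel Un_absorb1[OF sub])
    show "disjoint_family_on V {1..?k}"
      unfolding disjoint_family_on_def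
    proof (intro ballI impI)
      fix i j assume ij: "i \<in> {1..?k}" "j \<in> {1..?k}" "i \<noteq> j"
      have W: "i \<le> t \<Longrightarrow> j \<le> t \<Longrightarrow> W i \<inter> W j = {}"
        using disj ij by (auto simp: disjoint_family_on_def)
      show "V i \<inter> V j = {}"
        using ij W hR[of i] hR[of j] h_inj[of i j] by (auto simp: V_def)
    qed
  next
    fix i u v assume "i \<in> {1..?k}" "u \<in> V i" "v \<in> V i" "u \<noteq> v"
    then show "ereal (real (i + 1)) \<le> graph_dist G u v"
      using dist[of i u v] by (auto simp: V_def split: if_splits)
  qed
  then show ?thesis by (intro exI)
qed

text \<open>The disjoint codes \<open>W i\<close> attain the Singleton bound, so coloring them first
  and the remaining vertices singly meets the counting bound. The additive form avoids truncated
  subtraction.\<close>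

lemma packing_chromatic_number_hamming_graph:
  assumes q: "q > 0"
    and sub: "\<And>i. i \<in> {1..m - 1} \<Longrightarrow> W i \<subseteq> pverts (hamming_graph q m)"
    and disj: "disjoint_family_on W {1..m - 1}"
    and dist: "\<And>i u v. \<lbrakk>i \<in> {1..m - 1}; u \<in> W i; v \<in> W i; u \<noteq> v\<rbrakk> \<Longrightarrow> i < hamming_dist m u v"
    and card: "\<And>i. i \<in> {1..m - 1} \<Longrightarrow> card (W i) = q ^ (m - i)"
  shows "packing_chromatic_number (hamming_graph q m) + (\<Sum>i = 1..m - 1. q ^ (m - i)) =
    m - 1 + q ^ m"
proof -
  let ?G = "hamming_graph q m"
  let ?U = "\<Union>i\<in>{1..m - 1}. W i"
  let ?S = "\<Sum>i = 1..m - 1. q ^ (m - i)"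
  have U: "?U \<subseteq> pverts ?G"
    using sub by blast
  have "card ?U = (\<Sum>i = 1..m - 1. card (W i))"
    using disj finite_subset[OF sub finite_pverts_hamming_graph]
    by (intro card_UN_disjoint) (auto simp: disjoint_family_on_def)
  then have cU: "card ?U = ?S"
    using card by simp
  \<comment> \<open>Disjoint codes fit into the vertex set, so \<open>q ^ m - ?S\<close> is a
    genuine difference.\<close>
  have S: "?S \<le> q ^ m"
    using card_mono[OF finite_pverts_hamming_graph U]
    unfolding cU card_pverts_hamming_graph .
  have cR: "card (pverts ?G - ?U) = q ^ m - ?S"
    by (subst card_Diff_subset[OF finite_subset[OF U finite_pverts_hamming_graph] U])
      (simp only: cU card_pverts_hamming_graph)
  have "\<exists>V. packing_coloring ?G (m - 1 + (q ^ m - ?S)) V"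
    unfolding cR[symmetric]
  proof (rule packing_coloring_extend_by_singletons[OF finite_pverts_hamming_graph U disj])
    fix i u v assume *: "i \<in> {1..m - 1}" "u \<in> W i" "v \<in> W i" "u \<noteq> v"
    then have "u \<in> pverts ?G" "v \<in> pverts ?G" "i < hamming_dist m u v"
      using sub dist by blast+
    then show "ereal (real (i + 1)) \<le> graph_dist ?G u v"
      by (simp add: graph_dist_hamming_graph)
  qed
  moreover have "m - 1 + (q ^ m - ?S) \<le> k" if "\<exists>V. packing_coloring ?G k V" for k
  proof -
    have bound: "q ^ m \<le> (\<Sum>i = 1..k. q ^ (m - i))"
      using that hamming_packing_coloring_bound by blast
    show ?thesis
    proof (cases "m - 1 \<le> k")
      case True
      then have "{1..k} = {1..m - 1} \<union> {m - 1<..k}"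
        by auto
      then have "(\<Sum>i = 1..k. q ^ (m - i)) = ?S + (\<Sum>i\<in>{m - 1<..k}. q ^ (m - i))"
        by (simp add: sum.union_disjoint[symmetric] ivl_disj_int)
      \<comment> \<open>From color \<open>m\<close> on the exponent is 0: each further class covers
        at most one vertex.\<close>
      also have "(\<Sum>i\<in>{m - 1<..k}. q ^ (m - i)) = (\<Sum>i\<in>{m - 1<..k}. 1)"
        by (rule sum.cong) auto
      finally show ?thesis
        using bound True S by (simp only: sum_constant card_greaterThanAtMost of_nat_id mult_1_right) linarith
    next
      case False
      \<comment> \<open>With fewer than \<open>m - 1\<close> colors the sum misses the positive term
        at \<open>m - 1\<close>, so it falls below \<open>?S\<close> and hence below
        \<open>q ^ m\<close>, against \<open>bound\<close>.\<close>
      then have "(\<Sum>i = 1..k. q ^ (m - i)) < ?S"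
        using q by (intro sum_strict_mono2[where b = "m - 1"]) auto
      then show ?thesis
        using bound S by simp
    qed
  qed
  ultimately have "packing_chromatic_number ?G = m - 1 + (q ^ m - ?S)"
    unfolding packing_chromatic_number_def by (intro Least_equality)
  then show ?thesis
    using S by simp
qed

section \<open>Codes for dimensions two and three\<close>

lemma packing_chromatic_number_hamming_graph_2:
  assumes "q > 0"
  shows "packing_chromatic_number (hamming_graph q 2) + q = 1 + q ^ 2"
proof -
  \<comment> \<open>Only index 1 is used, so a constant family suffices.\<close>
  define W where "W = (\<lambda>i::nat. (\<lambda>x. [x, x]) ` {..<q})"
  have "packing_chromatic_number (hamming_graph q 2) + (\<Sum>i = 1..2 - 1. q ^ (2 - i)) = 2 - 1 + q ^ 2"
  proof (rule packing_chromatic_number_hamming_graph[of q 2 W, OF assms])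
    show "W i \<subseteq> pverts (hamming_graph q 2)" for i
      by (auto simp: W_def pverts_hamming_graph)
    show "disjoint_family_on W {1..2 - 1}"
      by (auto simp: disjoint_family_on_def)
    show "i < hamming_dist 2 u v" if "i \<in> {1..2 - 1}" "u \<in> W i" "v \<in> W i" "u \<noteq> v" for i u v
      using that by (auto simp: W_def numeral_2_eq_2 of_bool_def split: if_splits)
    show "card (W i) = q ^ (2 - i)" if "i \<in> {1..2 - 1}" for i
      using that by (auto simp: W_def card_image inj_on_def)
  qed
  then show ?thesis
    by simp
qed

text \<open>Keeps the two codes in dimension three disjoint. At 1 it compares 0 with 2 mod
  \<open>q\<close>, which would coincide for \<open>q = 2\<close>.\<close>

lemma transpose_0_1_neq_double_mod:
  fixes q :: nat
  assumes "q \<ge> 3" "i < q"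
  shows "transpose 0 1 i \<noteq> (i + i) mod q"
proof -
  consider "i = 0" | "i = 1" | "i \<noteq> 0" "i \<noteq> 1"
    by blast
  then show ?thesis
  proof cases
    case 3
    \<comment> \<open>Equality would make \<open>i\<close> a multiple of \<open>q\<close>, although
      0 < i < q.\<close>
    then have "(i + i) mod q \<noteq> i"
      using assms(2) by (cases "i + i < q") (auto simp: mod_if)
    then show ?thesis
      using 3 by (simp add: transpose_def)
  qed (use assms in \<open>auto simp: transpose_def\<close>)
qed

lemma packing_chromatic_number_hamming_graph_3:
  assumes q: "q \<ge> 3"
  shows "packing_chromatic_number (hamming_graph q 3) + (q ^ 2 + q) = 2 + q ^ 3"
proof -
  define A where "A = (\<lambda>(x, y). [x, y, (x + y) mod q]) ` ({..<q} \<times> {..<q})"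
  define B where "B = (\<lambda>x. [x, x, transpose 0 1 x]) ` {..<q}"
  define W where "W i = (if i = 1 then A else B)" for i :: nat
  have add_mod_cancel: "b = c" if "(a + b) mod q = (a + c) mod q" "b < q" "c < q" for a b c
    using that by (metis cong_add_lcancel_nat unique_euclidean_semiring_class.cong_def mod_less)
  \<comment> \<open>Any two coordinates of a word in \<open>A\<close> determine the third, so
    distinct words agree in at most one place.\<close>
  have A_dist: "1 < hamming_dist 3 u v" if uv: "u \<in> A" "v \<in> A" "u \<noteq> v" for u v
  proof -
    obtain x y z w where
      "u = [x, y, (x + y) mod q]" "v = [z, w, (z + w) mod q]" "x < q" "y < q" "z < q" "w < q"
      using uv(1,2) by (auto simp: A_def)
    then show ?thesis
      using uv(3) add_mod_cancel[of x y w] add_mod_cancel[of y x z]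
      by (auto simp: numeral_3_eq_3 add.commute)
  qed
  \<comment> \<open>Each single coordinate determines \<open>x\<close>, because a transposition is
    injective.\<close>
  have B_dist: "2 < hamming_dist 3 u v" if "u \<in> B" "v \<in> B" "u \<noteq> v" for u v
    using that by (auto simp: B_def numeral_3_eq_3 of_bool_def dest: transpose_eq_imp_eq split: if_splits)
  have range: "{1..3 - 1} = {1, 2 :: nat}"
    by auto
  have AB: "A \<inter> B = {}"
    \<comment> \<open>A common word would have equal first entries \<open>i\<close> and last entry
      both \<open>transpose 0 1 i\<close> and \<open>(i + i) mod q\<close>.\<close>
    using transpose_0_1_neq_double_mod[OF q] by (fastforce simp: A_def B_def)
  have "packing_chromatic_number (hamming_graph q 3) + (\<Sum>i = 1..3 - 1. q ^ (3 - i)) = 3 - 1 + q ^ 3"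
  proof (rule packing_chromatic_number_hamming_graph[of q 3 W])
    show "q > 0" using q by simp
    have "A \<subseteq> pverts (hamming_graph q 3)"
      using q by (auto simp: A_def pverts_hamming_graph)
    moreover have "B \<subseteq> pverts (hamming_graph q 3)"
      using q by (auto simp: B_def pverts_hamming_graph transpose_def)
    ultimately show "W i \<subseteq> pverts (hamming_graph q 3)" for i
      by (simp add: W_def)
    show "disjoint_family_on W {1..3 - 1}"
      unfolding range disjoint_family_on_def using AB by (simp add: W_def Int_commute)
    show "i < hamming_dist 3 u v" if "i \<in> {1..3 - 1}" "u \<in> W i" "v \<in> W i" "u \<noteq> v" for i u v
      using that A_dist[of u v] B_dist[of u v] unfolding range by (auto simp: W_def)
    have "card A = q ^ 2" "card B = q"
      by (auto simp: A_def B_def card_image inj_on_def power2_eq_square)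
    then show "card (W i) = q ^ (3 - i)" if "i \<in> {1..3 - 1}" for i
      using that unfolding range by (auto simp: W_def)
  qed
  then show ?thesis
    by (simp add: numeral_2_eq_2)
qed

theorem theorem1:
  shows "(\<forall>q::nat. q \<ge> 2 \<longrightarrow>
            int (packing_chromatic_number (hamming_graph q 2)) = 1 + int q ^ 2 - int q) \<and>
         (\<forall>q::nat. q \<ge> 3 \<longrightarrow>
            int (packing_chromatic_number (hamming_graph q 3)) = 2 + int q ^ 3 - int q ^ 2 - int q)"
proof (intro conjI allI impI)
  fix q :: nat assume "q \<ge> 2"
  then have "int (packing_chromatic_number (hamming_graph q 2) + q) = int (1 + q ^ 2)"
    by (subst packing_chromatic_number_hamming_graph_2) simp_all
  then show "int (packing_chromatic_number (hamming_graph q 2)) = 1 + int q ^ 2 - int q"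
    by simp
next
  fix q :: nat assume "q \<ge> 3"
  then have "int (packing_chromatic_number (hamming_graph q 3) + (q ^ 2 + q)) = int (2 + q ^ 3)"
    by (subst packing_chromatic_number_hamming_graph_3) simp_all
  then show "int (packing_chromatic_number (hamming_graph q 3)) =
      2 + int q ^ 3 - int q ^ 2 - int q"
    by simp
qed

end
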